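(* There is an absolute constant $C>0$ such that for every integer $M\ge 2$, setting $n=\lceil \log_2 M\rceil$, there is a quantum circuit on exactly $n$ qubits (no ancilla qubits) that maps $|0\rangle^{\otimes n}$ to $$|\Psi\rangle=\frac{1}{\sqrt{M}}\sum_{j=0}^{M-1}|j\rangle ,$$ all of whose gates are single-qubit gates of the types $X$, $H$, $R_Y(\theta)$ ($\theta\in\mathbb{R}$) or singly-controlled gates of the types controlled-$H$, controlled-$R_Y(\theta)$, and whose number of gates and circuit depth are both at most $C\log_2 M$. More precisely: if $M=2^r$ with $r\ge 1$, then $r$ Hadamard gates suffice. If $M$ is not a power of $2$ and $M=\sum_{j=0}^{k}2^{l_j}$ with integers $0\le l_0<l_1<\dots<l_k$ is its binary expansion, then the circuit can be chosen with exactly $l_k+2k$ gates, namely $k$ gates $X$, $1$ gate $R_Y(\theta)$, $l_0$ gates $H$, $l_k-l_0$ controlled-$H$ gates, and $k-1$ controlled-$R_Y(\theta)$ gates. Moreover, there is also such an $n$-qubit circuit preparing $|\Psi\rangle$ consisting only of single-qubit gates and CNOT gates, with at most $C\log_2 M$ gates in total.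
   Context: Qubits are labelled $q_{n-1},\dots,q_0$, and for an integer $0\le j<2^n$ with binary expansion $j=\sum_{i=0}^{n-1}j_i2^i$, $|j\rangle$ denotes the computational basis state $|j_{n-1}\rangle\otimes\cdots\otimes|j_0\rangle$, where $j_i$ is the value of qubit $q_i$. $X$ is the Pauli-$X$ gate, $H$ is the Hadamard gate, and $$R_Y(\theta)=\begin{bmatrix}\cos\frac{\theta}{2}&-\sin\frac{\theta}{2}\\ \sin\frac{\theta}{2}&\cos\frac{\theta}{2}\end{bmatrix}.$$ For a single-qubit gate $V$, a controlled-$V$ gate has one control qubit and one (different) target qubit; here open controls are used: $V$ is applied to the target if the control is $|0\rangle$ and the identity is applied if the control is $|1\rangle$. CNOT is the usual controlled-$X$ gate with control value $1$. Circuit depth is the minimal number of layers when the gates are arranged so that gates in one layer act on disjoint sets of qubits. *)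

theory Defs
  imports Complex_Main "Jordan_Normal_Form.Schur_Decomposition"
begin

text \<open>
  States of n qubits are vectors of dimension \<open>2 ^ n\<close>. Coordinate \<open>j\<close> belongs to the basis state
  \<open>|j\<^sub>n\<^sub>-\<^sub>1> \<otimes> \<dots> \<otimes> |j\<^sub>0>\<close>, where the value \<open>j\<^sub>q\<close> of qubit \<open>q\<close> is the \<open>q\<close>-th binary digit of \<open>j\<close>,
  that is \<open>bit j q\<close>.
\<close>

abbreviation ket :: "nat \<Rightarrow> nat \<Rightarrow> complex vec"
  where "ket n j \<equiv> unit_vec (2 ^ n) j"

definition uniform_state :: "nat \<Rightarrow> nat \<Rightarrow> complex vec"
  where "uniform_state n M =
    complex_of_real (1 / sqrt (real M)) \<cdot>\<^sub>v finsum_vec TYPE(complex) (2 ^ n) (ket n) {..<M}"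

definition PauliX :: "complex mat"
  where "PauliX = mat_of_rows_list 2 [[0, 1], [1, 0]]"

definition Hadamard :: "complex mat"
  where "Hadamard = complex_of_real (1 / sqrt 2) \<cdot>\<^sub>m mat_of_rows_list 2 [[1, 1], [1, -1]]"

definition RotY :: "real \<Rightarrow> complex mat"
  where "RotY \<theta> = map_mat complex_of_real
    (mat_of_rows_list 2 [[cos (\<theta> / 2), - sin (\<theta> / 2)], [sin (\<theta> / 2), cos (\<theta> / 2)]])"

definition single_qubit_unitary :: "complex mat \<Rightarrow> bool"
  where "single_qubit_unitary V \<longleftrightarrow> V \<in> carrier_mat 2 2 \<and> mat_adjoint V * V = 1\<^sub>m 2"

text \<open>
  \<open>Single V q\<close> applies \<open>V\<close> to qubit \<open>q\<close>. \<open>Controlled b V c t\<close> applies \<open>V\<close> to the target qubit \<open>t\<close>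
  if the control qubit \<open>c\<close> has value \<open>b\<close>; an open control is thus \<open>b = False\<close>.
\<close>

datatype gate =
    Single "complex mat" nat
  | Controlled bool "complex mat" nat nat

abbreviation CNOT :: "nat \<Rightarrow> nat \<Rightarrow> gate"
  where "CNOT c t \<equiv> Controlled True PauliX c t"

fun gate_qubits :: "gate \<Rightarrow> nat set"
  where
    "gate_qubits (Single V q) = {q}"
  | "gate_qubits (Controlled b V c t) = {c, t}"

fun valid_gate :: "nat \<Rightarrow> gate \<Rightarrow> bool"
  where
    "valid_gate n (Single V q) \<longleftrightarrow> single_qubit_unitary V \<and> q < n"
  | "valid_gate n (Controlled b V c t) \<longleftrightarrow> single_qubit_unitary V \<and> c < n \<and> t < n \<and> c \<noteq> t"

text \<open>
  The entries of \<open>I \<otimes> \<dots> \<otimes> V \<otimes> \<dots> \<otimes> I\<close> with \<open>V\<close> in the position of qubit \<open>q\<close>.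
\<close>

definition on_qubit_entry :: "complex mat \<Rightarrow> nat \<Rightarrow> nat \<Rightarrow> nat \<Rightarrow> complex"
  where "on_qubit_entry V q i j =
    (if \<forall>p. p \<noteq> q \<longrightarrow> bit i p = bit j p
     then V $$ (of_bool (bit i q), of_bool (bit j q)) else 0)"

fun gate_mat :: "nat \<Rightarrow> gate \<Rightarrow> complex mat"
  where
    "gate_mat n (Single V q) = mat (2 ^ n) (2 ^ n) (\<lambda>(i, j). on_qubit_entry V q i j)"
  | "gate_mat n (Controlled b V c t) = mat (2 ^ n) (2 ^ n)
      (\<lambda>(i, j). if bit j c = b then on_qubit_entry V t i j else of_bool (i = j))"

text \<open>
  A circuit is the list of its gates in the order in which they are applied.
\<close>

type_synonym circuit = "gate list"

definition circuit_on :: "nat \<Rightarrow> circuit \<Rightarrow> bool"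
  where "circuit_on n gs \<longleftrightarrow> (\<forall>g \<in> set gs. valid_gate n g)"

definition run_circuit :: "nat \<Rightarrow> circuit \<Rightarrow> complex vec \<Rightarrow> complex vec"
  where "run_circuit n gs v = fold (\<lambda>g w. gate_mat n g *\<^sub>v w) gs v"

text \<open>
  Gate number \<open>i\<close> is put into layer \<open>L i < d\<close>. Gates sharing a qubit go to different layers and
  keep their order; in particular, gates in one layer act on disjoint sets of qubits.
\<close>

definition layering :: "circuit \<Rightarrow> nat \<Rightarrow> (nat \<Rightarrow> nat) \<Rightarrow> bool"
  where "layering gs d L \<longleftrightarrow>
    (\<forall>i < length gs. L i < d) \<and>
    (\<forall>i j. i < j \<longrightarrow> j < length gs \<longrightarrow> gate_qubits (gs ! i) \<inter> gate_qubits (gs ! j) \<noteq> {} \<longrightarrow> L i < L j)"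

definition depth :: "circuit \<Rightarrow> nat"
  where "depth gs = (LEAST d. \<exists>L. layering gs d L)"

definition is_X :: "gate \<Rightarrow> bool"
  where "is_X g \<longleftrightarrow> (\<exists>q. g = Single PauliX q)"

definition is_H :: "gate \<Rightarrow> bool"
  where "is_H g \<longleftrightarrow> (\<exists>q. g = Single Hadamard q)"

definition is_RY :: "gate \<Rightarrow> bool"
  where "is_RY g \<longleftrightarrow> (\<exists>\<theta> q. g = Single (RotY \<theta>) q)"

definition is_open_CH :: "gate \<Rightarrow> bool"
  where "is_open_CH g \<longleftrightarrow> (\<exists>c t. g = Controlled False Hadamard c t)"

definition is_open_CRY :: "gate \<Rightarrow> bool"
  where "is_open_CRY g \<longleftrightarrow> (\<exists>\<theta> c t. g = Controlled False (RotY \<theta>) c t)"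

definition is_single :: "gate \<Rightarrow> bool"
  where "is_single g \<longleftrightarrow> (\<exists>V q. g = Single V q)"

definition is_CNOT :: "gate \<Rightarrow> bool"
  where "is_CNOT g \<longleftrightarrow> (\<exists>c t. g = CNOT c t)"

abbreviation count_gates :: "(gate \<Rightarrow> bool) \<Rightarrow> circuit \<Rightarrow> nat"
  where "count_gates P gs \<equiv> length (filter P gs)"

definition prepares_uniform :: "nat \<Rightarrow> nat \<Rightarrow> circuit \<Rightarrow> bool"
  where "prepares_uniform n M gs \<longleftrightarrow>
    circuit_on n gs \<and> run_circuit n gs (ket n 0) = uniform_state n M"

end

theory Submission
  imports Defs "HOL-Library.Nat_Bijection"
begin

text \<open>
  All intermediate states are combinations of indicator functions of intervals of basis states.
  Write \<open>T\<^sub>m\<close> for the sum of the powers \<open>2 ^ l\<^sub>j\<close> with \<open>j \<ge> m\<close>. After stage \<open>m\<close> the state is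
  \<open>1 / sqrt M\<close> on \<open>[T\<^sub>m, M)\<close>, which is already final, plus a constant on
  \<open>[T\<^sub>m\<^sub>+\<^sub>1, T\<^sub>m\<^sub>+\<^sub>1 + 2 ^ l\<^sub>m)\<close>. Qubit \<open>l\<^sub>m\<close> distinguishes the two parts. The next rotation, on qubit
  \<open>l\<^sub>m\<^sub>+\<^sub>1\<close> and controlled by qubit \<open>l\<^sub>m\<close>, leaves the amplitude \<open>1 / sqrt M\<close> on the second interval and
  moves the remaining weight down by \<open>2 ^ l\<^sub>m\<^sub>+\<^sub>1\<close>; the Hadamard gates controlled by qubit \<open>l\<^sub>m\<^sub>+\<^sub>1\<close> then
  double the length of the moved interval until it is \<open>2 ^ l\<^sub>m\<^sub>+\<^sub>1\<close>. For the CNOT version, every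
  controlled gate is replaced by four gates.
\<close>

section \<open>Gates as operators on amplitude functions\<close>

definition qubit_act :: "complex mat \<Rightarrow> nat \<Rightarrow> (nat \<Rightarrow> complex) \<Rightarrow> nat \<Rightarrow> complex"
  where "qubit_act V q f i =
    V $$ (of_bool (bit i q), 0) * f (unset_bit q i) + V $$ (of_bool (bit i q), 1) * f (set_bit q i)"

text \<open>Amplitudes are functions on all natural numbers, so the number of qubits disappears from
  the calculations; \<open>run_circuit_vec\<close> restricts to the first \<open>2 ^ n\<close>
  coordinates at the end.\<close>

fun gate_act :: "gate \<Rightarrow> (nat \<Rightarrow> complex) \<Rightarrow> nat \<Rightarrow> complex"
  where
    "gate_act (Single V q) f = qubit_act V q f"
  | "gate_act (Controlled b V c t) f = (\<lambda>i. if bit i c = b then qubit_act V t f i else f i)"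

lemma set_bit_less_power: "i < 2 ^ n \<Longrightarrow> q < n \<Longrightarrow> set_bit q i < 2 ^ n" for i :: nat
  by (metis take_bit_nat_eq_self_iff take_bit_set_bit_eq not_le)

text \<open>Setting the bit again recovers \<open>set_bit q i\<close>, whose additive formula can
  then be solved for \<open>unset_bit q i\<close>.\<close>

lemma unset_bit_nat_eq: "unset_bit q i = i - of_bool (bit i q) * 2 ^ q" for i :: nat
proof -
  have "set_bit q (unset_bit q i) = set_bit q i"
    by (rule bit_eqI) (auto simp: bit_set_bit_iff bit_unset_bit_iff)
  moreover have "unset_bit q i = i" if "\<not> bit i q"
    by (rule bit_eqI) (use that in \<open>auto simp: bit_unset_bit_iff\<close>)
  ultimately show ?thesis
    by (auto simp: set_bit_eq bit_unset_bit_iff split: if_splits)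
qed

lemma unset_bit_less_power: "i < 2 ^ n \<Longrightarrow> unset_bit q i < 2 ^ n" for i :: nat
  by (rule le_less_trans) (auto simp: unset_bit_nat_eq)

text \<open>Row \<open>i\<close> of an embedded single-qubit matrix can be nonzero in these two
  columns only, so the sum over \<open>2 ^ n\<close> columns collapses to the two terms of
  \<open>qubit_act\<close>.\<close>

lemma agree_off_qubit_iff:
  "(\<forall>p. p \<noteq> q \<longrightarrow> bit i p = bit j p) \<longleftrightarrow> j = unset_bit q i \<or> j = set_bit q i" for i j :: nat
proof
  assume *: "\<forall>p. p \<noteq> q \<longrightarrow> bit i p = bit j p"
  have "j = (if bit j q then set_bit q i else unset_bit q i)"
    by (rule bit_eqI) (use * in \<open>auto simp: bit_set_bit_iff bit_unset_bit_iff\<close>)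
  then show "j = unset_bit q i \<or> j = set_bit q i" by (metis (full_types))
qed (auto simp: bit_set_bit_iff bit_unset_bit_iff)

lemma sum_on_qubit_entry:
  assumes "i < 2 ^ n" "q < n"
  shows "(\<Sum>j = 0..<2 ^ n. on_qubit_entry V q i j * f j) = qubit_act V q f i"
proof -
  have ne: "unset_bit q i \<noteq> set_bit q i"
  proof
    assume "unset_bit q i = set_bit q i"
    then have "bit (unset_bit q i) q = bit (set_bit q i) q" by simp
    then show False by (simp add: bit_set_bit_iff bit_unset_bit_iff)
  qed
  have "(\<Sum>j = 0..<2 ^ n. on_qubit_entry V q i j * f j) =
      (\<Sum>j \<in> {unset_bit q i, set_bit q i}. on_qubit_entry V q i j * f j)"
    by (rule sum.mono_neutral_right)
      (use assms set_bit_less_power unset_bit_less_power in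
        \<open>auto simp: on_qubit_entry_def agree_off_qubit_iff\<close>)
  also have "\<dots> = qubit_act V q f i"
    using ne by (simp add: on_qubit_entry_def agree_off_qubit_iff qubit_act_def
        bit_set_bit_iff bit_unset_bit_iff)
  finally show ?thesis .
qed

lemma gate_mat_mult_vec:
  assumes "valid_gate n g"
  shows "gate_mat n g *\<^sub>v vec (2 ^ n) f = vec (2 ^ n) (gate_act g f)"
proof (cases g)
  case (Single V q)
  then show ?thesis using assms
    by (intro eq_vecI) (simp_all add: scalar_prod_def sum_on_qubit_entry)
next
  case (Controlled b V c t)
  have "(\<Sum>j = 0..<2 ^ n. (if bit j c = b then on_qubit_entry V t i j else of_bool (i = j)) * f j) =
      (if bit i c = b then qubit_act V t f i else f i)" if i: "i < 2 ^ n" for i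
  proof -
    \<comment> \<open>The matrix tests the control in the column index \<open>j\<close>, the action
      in the row index \<open>i\<close>. A nonzero entry forces \<open>i\<close> and
      \<open>j\<close> to agree off \<open>t\<close>, in particular at \<open>c\<close>.\<close>
    have "(if bit j c = b then on_qubit_entry V t i j else of_bool (i = j)) * f j =
        (if bit i c = b then on_qubit_entry V t i j * f j else if j = i then f j else 0)" for j
      using assms Controlled by (auto simp: on_qubit_entry_def)
    then show ?thesis
      using i assms Controlled by (simp add: sum_on_qubit_entry)
  qed
  then show ?thesis using Controlled
    by (intro eq_vecI) (simp_all add: scalar_prod_def)
qed

lemma run_circuit_vec:
  "circuit_on n gs \<Longrightarrow> run_circuit n gs (vec (2 ^ n) f) = vec (2 ^ n) (fold gate_act gs f)"
  by (induction gs arbitrary: f) (auto simp: run_circuit_def circuit_on_def gate_mat_mult_vec)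


section \<open>Entries and unitarity of the elementary gates\<close>

lemma PauliX_index [simp]:
  "PauliX $$ (0, 0) = 0" "PauliX $$ (0, Suc 0) = 1" "PauliX $$ (Suc 0, 0) = 1" "PauliX $$ (Suc 0, Suc 0) = 0"
  by (simp_all add: PauliX_def mat_of_rows_list_def)

lemma Hadamard_index [simp]:
  "Hadamard $$ (0, 0) = of_real (1 / sqrt 2)" "Hadamard $$ (0, Suc 0) = of_real (1 / sqrt 2)"
  "Hadamard $$ (Suc 0, 0) = of_real (1 / sqrt 2)" "Hadamard $$ (Suc 0, Suc 0) = - of_real (1 / sqrt 2)"
  by (simp_all add: Hadamard_def mat_of_rows_list_def)

lemma RotY_index [simp]:
  "RotY \<theta> $$ (0, 0) = of_real (cos (\<theta> / 2))" "RotY \<theta> $$ (0, Suc 0) = - of_real (sin (\<theta> / 2))"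
  "RotY \<theta> $$ (Suc 0, 0) = of_real (sin (\<theta> / 2))" "RotY \<theta> $$ (Suc 0, Suc 0) = of_real (cos (\<theta> / 2))"
  by (simp_all add: RotY_def mat_of_rows_list_def)

lemma single_qubit_unitaryI:
  assumes V: "V \<in> carrier_mat 2 2"
    and entries: "\<And>i j. i < 2 \<Longrightarrow> j < 2 \<Longrightarrow>
      cnj (V $$ (0, i)) * V $$ (0, j) + cnj (V $$ (1, i)) * V $$ (1, j) = of_bool (i = j)"
  shows "single_qubit_unitary V"
  unfolding single_qubit_unitary_def
proof (intro conjI eq_matI)
  fix i j
  assume "i < dim_row (1\<^sub>m 2 :: complex mat)" and "j < dim_col (1\<^sub>m 2 :: complex mat)"
  then show "(mat_adjoint V * V) $$ (i, j) = 1\<^sub>m 2 $$ (i, j)"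
    using V entries[of i j]
    by (simp add: mat_adjoint_def mat_of_rows_def scalar_prod_def numeral_2_eq_2)
qed (use V in \<open>auto simp: mat_adjoint_def\<close>)

lemma single_qubit_unitary_PauliX: "single_qubit_unitary PauliX"
  by (rule single_qubit_unitaryI) 
    (auto simp: less_2_cases_iff, simp add: PauliX_def mat_of_rows_list_def numeral_2_eq_2)

lemma single_qubit_unitary_Hadamard: "single_qubit_unitary Hadamard"
  by (rule single_qubit_unitaryI)
    (auto simp: less_2_cases_iff simp flip: of_real_mult, simp add: Hadamard_def mat_of_rows_list_def numeral_2_eq_2)

lemma single_qubit_unitary_RotY: "single_qubit_unitary (RotY \<theta>)"
proof (rule single_qubit_unitaryI)
  have "complex_of_real (cos (\<theta> / 2)) * cos (\<theta> / 2) + complex_of_real (sin (\<theta> / 2)) * sin (\<theta> / 2) = 1"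
    unfolding of_real_mult[symmetric] of_real_add[symmetric] by (simp flip: power2_eq_square)
  then show "cnj (RotY \<theta> $$ (0, i)) * RotY \<theta> $$ (0, j) +
      cnj (RotY \<theta> $$ (1, i)) * RotY \<theta> $$ (1, j) = of_bool (i = j)" if "i < 2" "j < 2" for i j
    using that by (auto simp: less_2_cases_iff add.commute)
qed (simp add: RotY_def mat_of_rows_list_def numeral_2_eq_2)

section \<open>Gates acting on indicators of aligned intervals\<close>

definition interval :: "nat \<Rightarrow> nat \<Rightarrow> nat \<Rightarrow> complex"
  where "interval a b j = of_bool (a \<le> j \<and> j < b)"

text \<open>On each half of the aligned block \<open>[T, T + 2 ^ Suc p)\<close> the quotient
  \<open>j div 2 ^ p\<close> is constant: even on the lower half, odd on the upper half
  (\<open>bit_block\<close>).\<close>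

lemma not_bit_block:
  fixes j :: nat
  assumes "2 ^ Suc p dvd T" "T \<le> j" "j < T + 2 ^ p"
  shows "\<not> bit j p"
proof -
  obtain u where u: "T = 2 ^ p * (2 * u)" using assms(1) by (auto simp: dvd_def)
  have "j div 2 ^ p = 2 * u"
    by (rule div_nat_eqI) (use assms u in \<open>simp_all add: algebra_simps\<close>)
  then show ?thesis by (simp add: bit_iff_odd)
qed

lemma bit_block:
  fixes j :: nat
  assumes "2 ^ Suc p dvd T" "T + 2 ^ p \<le> j" "j < T + 2 ^ Suc p"
  shows "bit j p"
proof -
  obtain u where u: "T = 2 ^ p * (2 * u)" using assms(1) by (auto simp: dvd_def)
  have "j div 2 ^ p = 2 * u + 1"
    by (rule div_nat_eqI) (use assms u in \<open>simp_all add: algebra_simps\<close>)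
  then show ?thesis by (simp add: bit_iff_odd)
qed

lemma interval_block_low:
  assumes "2 ^ Suc p dvd T" and "a \<le> p" and "bit j p"
  shows "interval T (T + 2 ^ a) j = 0"
proof -
  have "(2::nat) ^ a \<le> 2 ^ p" using assms(2) by simp
  then have "\<not> (T \<le> j \<and> j < T + 2 ^ a)"
    using not_bit_block[OF assms(1), of j] assms(3) by linarith
  then show ?thesis by (simp add: interval_def)
qed

lemma interval_block_high:
  assumes "2 ^ Suc p dvd T" and "a \<le> p" and "\<not> bit j p"
  shows "interval (T + 2 ^ p) (T + 2 ^ p + 2 ^ a) j = 0"
proof -
  have "(2::nat) ^ a \<le> 2 ^ p" using assms(2) by simp
  then have "\<not> (T + 2 ^ p \<le> j \<and> j < T + 2 ^ p + 2 ^ a)"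
    using bit_block[OF assms(1), of j] assms(3) unfolding power_Suc by linarith
  then show ?thesis by (simp add: interval_def)
qed

lemma qubit_act_scale: "qubit_act V q (\<lambda>i. \<alpha> * f i) = (\<lambda>i. \<alpha> * qubit_act V q f i)"
  by (rule ext) (simp add: qubit_act_def algebra_simps)

text \<open>Bit \<open>q\<close> is 0 on the given interval, so only the first column of the matrix
  matters. Its two equal entries copy the interval to the upper half of the block.\<close>

lemma Hadamard_block:
  assumes "2 ^ Suc q dvd T"
  shows "qubit_act Hadamard q (interval T (T + 2 ^ q)) = (\<lambda>i. of_real (1 / sqrt 2) * interval T (T + 2 ^ Suc q) i)"
proof
  fix i
  show "qubit_act Hadamard q (interval T (T + 2 ^ q)) i = of_real (1 / sqrt 2) * interval T (T + 2 ^ Suc q) i"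
  proof (cases "bit i q")
    case True
    moreover have "2 ^ q \<le> i" using True by (metis bit_iff_odd div_less even_zero not_le)
    moreover have outside: "i < T \<or> T + 2 ^ q \<le> i"
      using not_bit_block[OF assms, of i] True by linarith
    \<comment> \<open>The two sides could differ only for \<open>i\<close> in the lower half, which
      \<open>outside\<close> excludes; \<open>2 ^ q \<le> i\<close> makes the truncated subtraction
      exact.\<close>
    moreover have "(T \<le> i - 2 ^ q \<and> i - 2 ^ q < T + 2 ^ q) \<longleftrightarrow> (T \<le> i \<and> i < T + 2 ^ Suc q)"
      using outside \<open>2 ^ q \<le> i\<close> unfolding power_Suc by linarith
    then have "interval T (T + 2 ^ q) (i - 2 ^ q) = interval T (T + 2 ^ Suc q) i"
      by (simp only: interval_def)
    moreover have "interval T (T + 2 ^ q) i = 0"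
      using outside by (auto simp: interval_def)
    ultimately show ?thesis
      by (simp add: qubit_act_def set_bit_eq unset_bit_nat_eq)
  next
    case False
    then have "bit (i + 2 ^ q) q" by (simp add: bit_iff_odd)
    then have "interval T (T + 2 ^ q) (i + 2 ^ q) = 0"
      by (rule interval_block_low[OF assms order_refl])
    moreover have "(T \<le> i \<and> i < T + 2 ^ q) \<longleftrightarrow> (T \<le> i \<and> i < T + 2 ^ Suc q)"
      using bit_block[OF assms, of i] False unfolding power_Suc by linarith
    then have "interval T (T + 2 ^ q) i = interval T (T + 2 ^ Suc q) i"
      by (simp only: interval_def)
    ultimately show ?thesis
      using False by (simp add: qubit_act_def set_bit_eq unset_bit_nat_eq)
  qed
qed

text \<open>The input lies where bit \<open>p\<close> is 1, so the second column of the rotation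
  applies: the cosine part stays, and the part with minus sine moves down by
  \<open>2 ^ p\<close>.\<close>

lemma RotY_block:
  assumes "2 ^ Suc p dvd T" and "a \<le> p"
  shows "qubit_act (RotY \<theta>) p (interval (T + 2 ^ p) (T + 2 ^ p + 2 ^ a)) =
    (\<lambda>i. of_real (cos (\<theta> / 2)) * interval (T + 2 ^ p) (T + 2 ^ p + 2 ^ a) i +
         of_real (- sin (\<theta> / 2)) * interval T (T + 2 ^ a) i)"
proof
  fix i
  show "qubit_act (RotY \<theta>) p (interval (T + 2 ^ p) (T + 2 ^ p + 2 ^ a)) i =
     of_real (cos (\<theta> / 2)) * interval (T + 2 ^ p) (T + 2 ^ p + 2 ^ a) i +
     of_real (- sin (\<theta> / 2)) * interval T (T + 2 ^ a) i"
  proof (cases "bit i p")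
    case True
    then have "\<not> bit (i - 2 ^ p) p" using bit_unset_bit_iff[of p i p] by (simp add: unset_bit_nat_eq)
    then have "interval (T + 2 ^ p) (T + 2 ^ p + 2 ^ a) (i - 2 ^ p) = 0" "interval T (T + 2 ^ a) i = 0"
      using interval_block_high[OF assms] interval_block_low[OF assms] True by blast+
    then show ?thesis
      using True by (simp add: qubit_act_def set_bit_eq unset_bit_nat_eq)
  next
    case False
    then have "interval (T + 2 ^ p) (T + 2 ^ p + 2 ^ a) i = 0"
      using interval_block_high[OF assms] by blast
    moreover have "interval (T + 2 ^ p) (T + 2 ^ p + 2 ^ a) (i + 2 ^ p) = interval T (T + 2 ^ a) i"
      by (auto simp: interval_def)
    ultimately show ?thesis
      using False by (simp add: qubit_act_def set_bit_eq unset_bit_nat_eq)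
  qed
qed

text \<open>A basis state is an interval of length one. Bit \<open>p\<close> of \<open>s\<close> is
  0, so flipping it adds \<open>2 ^ p\<close>.\<close>

lemma PauliX_basis:
  assumes "s < 2 ^ p"
  shows "qubit_act PauliX p (interval s (Suc s)) = interval (s + 2 ^ p) (Suc (s + 2 ^ p))"
proof
  fix i
  show "qubit_act PauliX p (interval s (Suc s)) i = interval (s + 2 ^ p) (Suc (s + 2 ^ p)) i"
  proof (cases "bit i p")
    case True
    then have "2 ^ p \<le> i" by (metis bit_iff_odd div_less even_zero not_le)
    then show ?thesis using True by (auto simp: qubit_act_def set_bit_eq unset_bit_nat_eq interval_def)
  next
    case False
    moreover have "i \<noteq> s + 2 ^ p" 
      using False bit_block[of p 0 "s + 2 ^ p"] assms by auto
    ultimately show ?thesis using assms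
      by (auto simp: qubit_act_def set_bit_eq unset_bit_nat_eq interval_def)
  qed
qed

text \<open>The control separates the supports: \<open>f\<close> lives on value 0 and
  \<open>g\<close> on value 1. Since \<open>c \<noteq> t\<close>, the action on the target does not
  mix the two.\<close>

lemma open_control_split:
  assumes "c \<noteq> t" and "\<And>i. bit i c \<Longrightarrow> f i = 0" and "\<And>i. \<not> bit i c \<Longrightarrow> g i = 0"
  shows "gate_act (Controlled False V c t) (\<lambda>i. \<alpha> * f i + \<beta> * g i) =
    (\<lambda>i. \<alpha> * qubit_act V t f i + \<beta> * g i)"
  by (rule ext) (use assms in \<open>auto simp: qubit_act_def bit_set_bit_iff bit_unset_bit_iff algebra_simps\<close>)

lemma Hadamard_chain:
  assumes "a \<le> b" and "2 ^ b dvd T"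
  shows "fold gate_act (map (Single Hadamard) [a..<b]) (interval T (T + 2 ^ a)) =
    (\<lambda>i. of_real (1 / sqrt 2) ^ (b - a) * interval T (T + 2 ^ b) i)"
  using assms
proof (induction b rule: dec_induct)
  case (step b)
  have "2 ^ b dvd T" using step.prems by (rule power_le_dvd) simp
  then show ?case
    using step by (simp add: qubit_act_scale Hadamard_block Suc_diff_le)
qed simp

text \<open>All targets lie below the control \<open>p\<close>, so the growing interval stays in the
  lower half of its block, where the control is 0. For \<open>b = p\<close> it fills that
  half.\<close>

lemma open_CH_chain:
  assumes "a \<le> b" and "b \<le> p" and T: "2 ^ Suc p dvd T" and g: "\<And>i. \<not> bit i p \<Longrightarrow> g i = 0"
  shows "fold gate_act (map (Controlled False Hadamard p) [a..<b])
      (\<lambda>i. \<alpha> * interval T (T + 2 ^ a) i + \<beta> * g i) =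
    (\<lambda>i. \<alpha> * of_real (1 / sqrt 2) ^ (b - a) * interval T (T + 2 ^ b) i + \<beta> * g i)"
  using assms(1,2)
proof (induction b rule: dec_induct)
  case (step b)
  have "interval T (T + 2 ^ b) i = 0" if "bit i p" for i
    by (rule interval_block_low[OF T _ that]) (use step.prems in simp)
  moreover have "2 ^ Suc b dvd T" using T by (rule power_le_dvd) (use step.prems in simp)
  ultimately show ?case
    using step g
    by (simp add: open_control_split Hadamard_block Suc_diff_le del: gate_act.simps)
qed simp

section \<open>Controlled gates from single-qubit gates and CNOTs\<close>

lemma unset_bit_unset_bit [simp]: "unset_bit t (unset_bit t i) = unset_bit t i"
  and unset_bit_set_bit [simp]: "unset_bit t (set_bit t i) = unset_bit t i"
  and set_bit_unset_bit [simp]: "set_bit t (unset_bit t i) = set_bit t i"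
  and set_bit_set_bit [simp]: "set_bit t (set_bit t i) = set_bit t i" for i :: nat
  by (rule bit_eqI, auto simp: bit_set_bit_iff bit_unset_bit_iff)+

text \<open>
  If the control is \<open>1\<close>, both CNOTs act and \<open>X R\<^sub>Y(\<theta>/2) X = R\<^sub>Y(-\<theta>/2)\<close> cancels the first rotation.
\<close>

lemma open_CRY_decomposition:
  assumes "c \<noteq> t"
  shows "fold gate_act [Single (RotY (\<theta> / 2)) t, CNOT c t, Single (RotY (\<theta> / 2)) t, CNOT c t] f =
    gate_act (Controlled False (RotY \<theta>) c t) f"
proof
  fix i
  define C S :: complex where "C = of_real (cos (\<theta> / 2 / 2))" and "S = of_real (sin (\<theta> / 2 / 2))"
  have one: "C * C + S * S = 1"
    unfolding C_def S_def of_real_mult[symmetric] of_real_add[symmetric] by (simp flip: power2_eq_square)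
  \<comment> \<open>With control 0 the two rotations by half the angle compose to the full one; this
    is the double-angle formula.\<close>
  have cos: "of_real (cos (\<theta> / 2)) = C * C - S * S" and sin: "of_real (sin (\<theta> / 2)) = 2 * S * C"
    using cos_double[of "\<theta> / 2 / 2"] sin_double[of "\<theta> / 2 / 2"]
    by (simp_all add: C_def S_def power2_eq_square)
  have RY: "RotY (\<theta> / 2) $$ (0, 0) = C" "RotY (\<theta> / 2) $$ (0, Suc 0) = - S"
    "RotY (\<theta> / 2) $$ (Suc 0, 0) = S" "RotY (\<theta> / 2) $$ (Suc 0, Suc 0) = C"
    by (simp_all add: C_def S_def)
  define x y where "x = f (unset_bit t i)" and "y = f (set_bit t i)"
  have fi: "f i = (if bit i t then y else x)"
    by (simp add: x_def y_def set_bit_eq unset_bit_nat_eq)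
  have id: "C * (C * u) + S * (S * u) = u" for u
    using arg_cong[OF one, of "\<lambda>v. v * u"] by (simp add: algebra_simps)
  show "fold gate_act [Single (RotY (\<theta> / 2)) t, CNOT c t, Single (RotY (\<theta> / 2)) t, CNOT c t] f i =
    gate_act (Controlled False (RotY \<theta>) c t) f i"
    using assms id[of x] id[of y]
    by (simp add: qubit_act_def bit_set_bit_iff bit_unset_bit_iff RY cos sin fi
        flip: x_def y_def del: RotY_index(1,2,3,4)) (simp add: cos sin algebra_simps)
qed

text \<open>
  \<open>H\<close> and \<open>X\<close> are reflections whose axes differ by the angle \<open>\<pi>/8\<close>, so the last three gates form an
  \<open>H\<close> controlled on \<open>1\<close>, which cancels the first \<open>H\<close> exactly if the control is \<open>1\<close>.
\<close>

lemma open_CH_decomposition: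
  assumes "c \<noteq> t"
  shows "fold gate_act [Single Hadamard t, Single (RotY (pi / 4)) t, CNOT c t, Single (RotY (- (pi / 4))) t] f =
    gate_act (Controlled False Hadamard c t) f"
proof
  fix i
  define C S R :: complex where "C = of_real (cos (pi / 4 / 2))" and "S = of_real (sin (pi / 4 / 2))"
    and "R = of_real (1 / sqrt 2)"
  have one: "C * C + S * S = 1"
    unfolding C_def S_def of_real_mult[symmetric] of_real_add[symmetric] by (simp flip: power2_eq_square)
  have R2: "R * R = 1 / 2"
    unfolding R_def of_real_mult[symmetric] by simp
  \<comment> \<open>The double-angle formulas at \<open>pi / 8\<close>: sine and cosine of
    \<open>pi / 4\<close> are both \<open>1 / sqrt 2\<close>.\<close>
  have cos: "C * C - S * S = R" and sin: "2 * S * C = R"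
    proof -
    have double: "2 * (pi / 4 / 2) = pi / 4" by simp
    have quarter: "cos (pi / 4) = 1 / sqrt 2" "sin (pi / 4) = 1 / sqrt 2"
      by (simp_all add: cos_45 sin_45 field_simps)
    have "cos (pi / 4 / 2) * cos (pi / 4 / 2) - sin (pi / 4 / 2) * sin (pi / 4 / 2) = 1 / sqrt 2"
      and "2 * sin (pi / 4 / 2) * cos (pi / 4 / 2) = 1 / sqrt 2"
      using cos_double[of "pi / 4 / 2", unfolded double quarter power2_eq_square, symmetric]
        sin_double[of "pi / 4 / 2", unfolded double quarter, symmetric] by blast+
    note this[THEN arg_cong[where f = complex_of_real]]
    then show "C * C - S * S = R" "2 * S * C = R"
      by (simp_all add: C_def S_def R_def)
  qed
  have RY: "RotY (pi / 4) $$ (0, 0) = C" "RotY (pi / 4) $$ (0, Suc 0) = - S"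
    "RotY (pi / 4) $$ (Suc 0, 0) = S" "RotY (pi / 4) $$ (Suc 0, Suc 0) = C"
    "RotY (- (pi / 4)) $$ (0, 0) = C" "RotY (- (pi / 4)) $$ (0, Suc 0) = S"
    "RotY (- (pi / 4)) $$ (Suc 0, 0) = - S" "RotY (- (pi / 4)) $$ (Suc 0, Suc 0) = C"
    by (simp_all add: C_def S_def)
  have H: "Hadamard $$ (0, 0) = R" "Hadamard $$ (0, Suc 0) = R"
    "Hadamard $$ (Suc 0, 0) = R" "Hadamard $$ (Suc 0, Suc 0) = - R"
    by (simp_all add: R_def)
  define x y where "x = f (unset_bit t i)" and "y = f (set_bit t i)"
  have fi: "f i = (if bit i t then y else x)"
    by (simp add: x_def y_def set_bit_eq unset_bit_nat_eq)
  \<comment> \<open>Control 0: the pair \<open>(u, v)\<close> is rotated to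
    \<open>(C * u - S * v, S * u + C * v)\<close> and back.\<close>
  have rotate_back: "C * (C * u - S * v) + S * (S * u + C * v) = u"
      "C * (S * u + C * v) - S * (C * u - S * v) = v" for u v
  proof -
    have "C * (C * u - S * v) + S * (S * u + C * v) = (C * C + S * S) * u"
      "C * (S * u + C * v) - S * (C * u - S * v) = (C * C + S * S) * v" by (simp_all add: algebra_simps)
    then show "C * (C * u - S * v) + S * (S * u + C * v) = u"
      "C * (S * u + C * v) - S * (C * u - S * v) = v" by (simp_all only: one mult_1)
  qed
  \<comment> \<open>Control 1: the CNOT swaps the two rotated amplitudes before they are rotated
    back, which amounts to a Hadamard gate.\<close>
  have reflect: "C * (S * u + C * v) + S * (C * u - S * v) = R * u + R * v"
      "C * (C * u - S * v) - S * (S * u + C * v) = R * u - R * v" for u v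
  proof -
    have "C * (S * u + C * v) + S * (C * u - S * v) = 2 * S * C * u + (C * C - S * S) * v"
      "C * (C * u - S * v) - S * (S * u + C * v) = (C * C - S * S) * u - 2 * S * C * v"
      by (simp_all add: algebra_simps)
    then show "C * (S * u + C * v) + S * (C * u - S * v) = R * u + R * v"
      "C * (C * u - S * v) - S * (S * u + C * v) = R * u - R * v" by (simp_all only: cos sin)
  qed
  \<comment> \<open>That gate meets the initial Hadamard gate, and the two cancel.\<close>
  have R_inv: "R * (R * x + R * y) + R * (R * x - R * y) = x"
      "R * (R * x + R * y) - R * (R * x - R * y) = y"
  proof -
    have "R * (R * x + R * y) + R * (R * x - R * y) = 2 * (R * R) * x"
      "R * (R * x + R * y) - R * (R * x - R * y) = 2 * (R * R) * y" by (simp_all add: algebra_simps)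
    then show "R * (R * x + R * y) + R * (R * x - R * y) = x"
      "R * (R * x + R * y) - R * (R * x - R * y) = y" by (simp_all add: R2)
  qed
  show "fold gate_act [Single Hadamard t, Single (RotY (pi / 4)) t, CNOT c t, Single (RotY (- (pi / 4))) t] f i =
    gate_act (Controlled False Hadamard c t) f i"
    using assms by (simp add: qubit_act_def bit_set_bit_iff bit_unset_bit_iff RY H fi
        rotate_back reflect R_inv flip: x_def y_def del: RotY_index Hadamard_index)
qed

section \<open>Disjointness of the gate types\<close>

lemma PauliX_neq_Hadamard: "PauliX \<noteq> Hadamard"
  and PauliX_neq_RotY: "PauliX \<noteq> RotY \<theta>"
  and Hadamard_neq_RotY: "Hadamard \<noteq> RotY \<theta>"
proof -
  show "PauliX \<noteq> Hadamard"
  proof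
    assume eq: "PauliX = Hadamard"
    have "Hadamard $$ (0, 0) = 0" unfolding eq[symmetric] by simp
    then show False by simp
  qed
  show "PauliX \<noteq> RotY \<theta>"
  proof
    assume eq: "PauliX = RotY \<theta>"
    have "PauliX $$ (0, 1) = - PauliX $$ (1, 0)" unfolding eq by simp
    then show False by simp
  qed
  show "Hadamard \<noteq> RotY \<theta>"
  proof
    assume eq: "Hadamard = RotY \<theta>"
    have "Hadamard $$ (0, 0) = Hadamard $$ (1, 1)" unfolding eq by simp
    then show False by (simp add: eq_neg_iff_add_eq_0)
  qed
qed

text \<open>Exact counts require that no gate is counted under two types, hence the matrix
  inequalities above.\<close>

lemma is_gate_simps [simp]:
  "is_X (Single PauliX q)" "\<not> is_X (Single Hadamard q)" "\<not> is_X (Single (RotY \<theta>) q)"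
  "\<not> is_X (Controlled b V c t)"
  "is_H (Single Hadamard q)" "\<not> is_H (Single PauliX q)" "\<not> is_H (Single (RotY \<theta>) q)"
  "\<not> is_H (Controlled b V c t)"
  "is_RY (Single (RotY \<theta>) q)" "\<not> is_RY (Single PauliX q)" "\<not> is_RY (Single Hadamard q)"
  "\<not> is_RY (Controlled b V c t)"
  "is_open_CH (Controlled False Hadamard c t)" "\<not> is_open_CH (Controlled False (RotY \<theta>) c t)"
  "\<not> is_open_CH (Single V q)"
  "is_open_CRY (Controlled False (RotY \<theta>) c t)" "\<not> is_open_CRY (Controlled False Hadamard c t)"
  "\<not> is_open_CRY (Single V q)"
  using PauliX_neq_Hadamard PauliX_neq_RotY Hadamard_neq_RotY
    PauliX_neq_Hadamard[symmetric] PauliX_neq_RotY[symmetric] Hadamard_neq_RotY[symmetric]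
  unfolding is_X_def is_H_def is_RY_def is_open_CH_def is_open_CRY_def gate.inject gate.distinct
  by blast+

section \<open>Binary expansions and their tails\<close>

locale binary_expansion =
  fixes k :: nat and l :: "nat \<Rightarrow> nat" and M :: nat
  assumes l_mono: "strict_mono_on {0..k} l"
    and M_eq: "M = (\<Sum>j = 0..k. 2 ^ l j)"
begin

definition tail :: "nat \<Rightarrow> nat"
  where "tail m = (\<Sum>j = m..k. 2 ^ l j)"

lemma l_less: "i < j \<Longrightarrow> j \<le> k \<Longrightarrow> l i < l j"
  using l_mono by (auto simp: strict_mono_on_def)

lemma l_le: "i \<le> j \<Longrightarrow> j \<le> k \<Longrightarrow> l i \<le> l j"
  using l_less[of i j] by (cases "i = j") auto

lemma k_le: "m \<le> k \<Longrightarrow> m \<le> l m"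
proof (induction m)
  case (Suc m)
  then show ?case using l_less[of m "Suc m"] by simp
qed simp

lemma tail_0: "tail 0 = M" by (simp add: tail_def M_eq)

lemma tail_Suc_k: "tail (Suc k) = 0" by (simp add: tail_def)

lemma tail_rec: "m \<le> k \<Longrightarrow> tail m = tail (Suc m) + 2 ^ l m"
  by (simp add: tail_def sum.atLeast_Suc_atMost)

text \<open>Every exponent left in the tail exceeds \<open>l m\<close>. This is the alignment that
  the block lemmas ask for.\<close>

lemma tail_dvd: "m \<le> k \<Longrightarrow> 2 ^ Suc (l m) dvd tail (Suc m)"
  unfolding tail_def by (intro dvd_sum le_imp_power_dvd) (auto intro: l_less simp: Suc_le_eq)

lemma tail_pos: "m \<le> k \<Longrightarrow> 0 < tail m"
  by (simp add: tail_rec)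

text \<open>The terms dropped from the tail are distinct powers below \<open>2 ^ l m\<close>, so
  they sum to less than \<open>2 ^ l m\<close>. In the induction, \<open>tail m + 2 ^ l m\<close>
  equals \<open>tail (Suc m) + 2 ^ Suc (l m)\<close>.\<close>

lemma M_less_tail: "m \<le> k \<Longrightarrow> M < tail m + 2 ^ l m"
proof (induction m)
  case 0
  then show ?case by (simp add: tail_0)
next
  case (Suc m)
  then have "2 ^ Suc (l m) \<le> (2::nat) ^ l (Suc m)"
    by (intro power_increasing) (auto simp: Suc_le_eq intro: l_less)
  then show ?case using Suc tail_rec[of m] by simp
qed

lemma M_upper: "M < 2 ^ Suc (l k)"
  using M_less_tail[of k] tail_rec[of k] by (simp add: tail_Suc_k)

lemma M_lower: "2 ^ l k \<le> M"
  unfolding M_eq by (rule member_le_sum) auto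

lemma sum_tail: "m \<le> k \<Longrightarrow> (\<Sum>j = 1..m. 2 ^ l j) + tail (Suc m) = tail 1"
proof (induction m)
  case (Suc m)
  then show ?case using tail_rec[of "Suc m"] by simp
qed simp

section \<open>The circuit and its intermediate states\<close>

definition angle :: "nat \<Rightarrow> real"
  where "angle m = - 2 * arccos (sqrt (2 ^ l m / tail m))"

text \<open>At stage 0 the finished interval \<open>[tail 0, M)\<close> is empty, so there is
  nothing for a control to protect.\<close>

definition rotation :: "nat \<Rightarrow> gate"
  where "rotation m = (if m = 0 then Single (RotY (angle 0)) (l 1)
    else Controlled False (RotY (angle m)) (l m) (l (Suc m)))"

definition stage :: "nat \<Rightarrow> circuit"
  where "stage m = rotation m # map (Controlled False Hadamard (l (Suc m))) [l m..<l (Suc m)]"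

text \<open>The X gates skip \<open>l 0\<close> and produce the basis state \<open>tail 1\<close>;
  the plain Hadamard gates spread it over \<open>2 ^ l 0\<close> states, which is
  \<open>state 0\<close>.\<close>

definition preparation :: circuit
  where "preparation = map (\<lambda>j. Single PauliX (l j)) [1..<Suc k] @
    map (Single Hadamard) [0..<l 0] @ concat (map stage [0..<k])"

text \<open>The unfinished interval carries probability \<open>tail m / M\<close> spread over
  \<open>2 ^ l m\<close> points, the finished one the remaining
  \<open>(M - tail m) / M\<close>.\<close>

definition state :: "nat \<Rightarrow> nat \<Rightarrow> complex"
  where "state m i = of_real (sqrt (tail m / (M * 2 ^ l m))) * interval (tail (Suc m)) (tail (Suc m) + 2 ^ l m) i +
    of_real (1 / sqrt M) * interval (tail m) M i"

lemma run_X: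
  assumes "m \<le> k"
  shows "fold gate_act (map (\<lambda>j. Single PauliX (l j)) [1..<Suc m]) (interval 0 (Suc 0)) =
    interval (\<Sum>j = 1..m. 2 ^ l j) (Suc (\<Sum>j = 1..m. 2 ^ l j))"
  using assms
proof (induction m)
  case (Suc m)
  \<comment> \<open>The sum is \<open>tail 1 - tail (Suc m)\<close>, which is below
    \<open>M - tail (Suc m)\<close>. The bound makes \<open>PauliX_basis\<close> applicable.\<close>
  have "(\<Sum>j = 1..m. 2 ^ l j) < (2::nat) ^ l (Suc m)"
    using sum_tail[of m] tail_rec[of 0] M_less_tail[of "Suc m"] Suc.prems by (simp add: tail_0)
  then show ?case using Suc by (simp add: PauliX_basis)
qed simp


text \<open>Of the weight \<open>tail m\<close>, the share \<open>2 ^ l m\<close> stays and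
  \<open>tail (Suc m)\<close> moves on; by \<open>tail_rec\<close> the squares add up to 1. The
  negative angle makes the moved amplitude nonnegative.\<close>

lemma cos_angle: "m \<le> k \<Longrightarrow> cos (angle m / 2) = sqrt (2 ^ l m / tail m)"
  and sin_angle: "m \<le> k \<Longrightarrow> - sin (angle m / 2) = sqrt (tail (Suc m) / tail m)"
proof -
  assume m: "m \<le> k"
  define x where "x = sqrt (2 ^ l m / tail m)"
  have t: "real (tail m) = tail (Suc m) + 2 ^ l m" using tail_rec[OF m] by simp
  have x: "0 \<le> x" "x \<le> 1" by (simp_all add: x_def t add_nonneg_pos)
  have half: "angle m / 2 = - arccos x" by (simp add: angle_def x_def)
  show "cos (angle m / 2) = sqrt (2 ^ l m / tail m)"
    using x by (simp add: half flip: x_def)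
  have "1 - x\<^sup>2 = tail (Suc m) / tail m"
    using tail_pos[OF m] by (simp add: x_def field_simps) (simp add: t)
  then show "- sin (angle m / 2) = sqrt (tail (Suc m) / tail m)"
    using x by (simp add: half sin_arccos)
qed

lemma M_pos: "0 < M"
  using tail_pos[of 0] by (simp add: tail_0)

lemma tail_le_M: "tail m \<le> M"
  unfolding tail_def M_eq by (rule sum_mono2) auto

text \<open>By \<open>M_less_tail\<close> the finished interval lies in the upper half of the block
  at \<open>tail (Suc m)\<close>, so an open control on \<open>l m\<close> shields it.\<close>

lemma interval_rest_high_bit:
  assumes "m \<le> k" and "\<not> bit i (l m)"
  shows "interval (tail m) M i = 0"
proof -
  have "bit i (l m)" if "tail m \<le> i" "i < M"
    using bit_block[OF tail_dvd[OF assms(1)], of i] that M_less_tail[OF assms(1)]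
    by (simp add: tail_rec[OF assms(1)])
  then show ?thesis using assms(2) by (auto simp: interval_def)
qed

lemma run_rotation:
  assumes "m < k"
  shows "gate_act (rotation m) (state m) =
    (\<lambda>i. of_real (sqrt (tail m / (M * 2 ^ l m))) *
           qubit_act (RotY (angle m)) (l (Suc m)) (interval (tail (Suc m)) (tail (Suc m) + 2 ^ l m)) i +
         of_real (1 / sqrt M) * interval (tail m) M i)"
proof (cases "m = 0")
  case True
  then have "interval (tail m) M = (\<lambda>i. 0)" by (auto simp: interval_def tail_0)
  then show ?thesis
    using True by (simp add: rotation_def state_def[abs_def] qubit_act_scale)
next
  case False
  then have rotation: "rotation m = Controlled False (RotY (angle m)) (l m) (l (Suc m))"
    by (simp add: rotation_def)
  have "interval (tail (Suc m)) (tail (Suc m) + 2 ^ l m) i = 0" if "bit i (l m)" for i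
    by (rule interval_block_low[OF tail_dvd _ that]) (use assms in auto)
  moreover have "interval (tail m) M i = 0" if "\<not> bit i (l m)" for i
    using interval_rest_high_bit that assms by simp
  moreover have "l m \<noteq> l (Suc m)" using l_less[of m "Suc m"] assms by simp
  ultimately show ?thesis
    unfolding rotation state_def[abs_def] by (intro open_control_split)
qed

lemma run_stage:
  assumes "m < k"
  shows "fold gate_act (stage m) (state m) = state (Suc m)"
proof -
  define A R r :: real where "A = sqrt (tail m / (M * 2 ^ l m))" and "R = 1 / sqrt M" and "r = 1 / sqrt 2"
  have l: "l m \<le> l (Suc m)" using l_le[of m "Suc m"] assms by simp
  have top: "tail (Suc m) = tail (Suc (Suc m)) + 2 ^ l (Suc m)" using tail_rec assms by simp
  have dvd: "2 ^ Suc (l (Suc m)) dvd tail (Suc (Suc m))" using tail_dvd assms by simp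
  have keep: "A * cos (angle m / 2) = R"
    using tail_pos[of m] assms
    by (simp add: A_def R_def cos_angle real_sqrt_divide real_sqrt_mult)
  have "A * - sin (angle m / 2) = sqrt (tail (Suc m) / (M * 2 ^ l m))"
    using tail_pos[of m] assms unfolding A_def
    by (subst sin_angle) (simp_all add: real_sqrt_divide real_sqrt_mult)
  moreover have "r ^ (l (Suc m) - l m) = sqrt (2 ^ l m / 2 ^ l (Suc m))"
  proof -
    have "r ^ (l (Suc m) - l m) = sqrt (1 / 2 ^ (l (Suc m) - l m))"
      by (simp add: r_def real_sqrt_divide real_sqrt_power power_divide)
    then show ?thesis using l by (simp add: power_diff)
  qed
  \<comment> \<open>The Hadamard factors replace \<open>2 ^ l m\<close> by
    \<open>2 ^ l (Suc m)\<close> in the denominator, which yields the amplitude required by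
    \<open>state (Suc m)\<close>.\<close>
  ultimately have move:
    "A * - sin (angle m / 2) * r ^ (l (Suc m) - l m) = sqrt (tail (Suc m) / (M * 2 ^ l (Suc m)))"
    by (simp only:) (simp add: real_sqrt_divide real_sqrt_mult)
  \<comment> \<open>The part kept by the rotation ends at \<open>tail m\<close>, exactly where the
    finished interval begins, and by \<open>keep\<close> both have amplitude
    \<open>1 / sqrt M\<close>.\<close>
  have join: "interval (tail (Suc m)) (tail (Suc m) + 2 ^ l m) i + interval (tail m) M i = interval (tail (Suc m)) M i" for i
    using tail_rec[of m] tail_le_M[of m] assms by (auto simp: interval_def)
  have "gate_act (rotation m) (state m) =
      (\<lambda>i. of_real (A * - sin (angle m / 2)) * interval (tail (Suc (Suc m))) (tail (Suc (Suc m)) + 2 ^ l m) i +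
        of_real R * interval (tail (Suc m)) M i)"
  proof
    fix i
    have "gate_act (rotation m) (state m) i =
        of_real (A * cos (angle m / 2)) * interval (tail (Suc m)) (tail (Suc m) + 2 ^ l m) i +
        of_real (A * - sin (angle m / 2)) * interval (tail (Suc (Suc m))) (tail (Suc (Suc m)) + 2 ^ l m) i +
        of_real R * interval (tail m) M i"
      unfolding run_rotation[OF assms] top RotY_block[OF dvd l] A_def R_def
      by (simp add: algebra_simps)
    then show "gate_act (rotation m) (state m) i =
      of_real (A * - sin (angle m / 2)) * interval (tail (Suc (Suc m))) (tail (Suc (Suc m)) + 2 ^ l m) i +
        of_real R * interval (tail (Suc m)) M i"
      unfolding keep join[symmetric] by (simp only: distrib_left ac_simps)
  qed
  then have "fold gate_act (stage m) (state m) =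
      (\<lambda>i. of_real (A * - sin (angle m / 2)) * of_real (1 / sqrt 2) ^ (l (Suc m) - l m) *
            interval (tail (Suc (Suc m))) (tail (Suc (Suc m)) + 2 ^ l (Suc m)) i +
        of_real R * interval (tail (Suc m)) M i)"
    \<comment> \<open>The control is now \<open>l (Suc m)\<close>: the enlarged finished interval
      has this bit set, the moved interval does not.\<close>
    unfolding stage_def fold_simps comp_def
    by (simp only:) (rule open_CH_chain[OF l order_refl dvd], rule interval_rest_high_bit, use assms in simp_all)
  also have "\<dots> = state (Suc m)"
    unfolding state_def[abs_def] move[symmetric] by (simp add: r_def R_def)
  finally show ?thesis .
qed

lemma run_stages: "m \<le> k \<Longrightarrow> fold gate_act (concat (map stage [0..<m])) (state 0) = state m"
  by (induction m) (simp_all add: run_stage)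

lemma run_preparation:
  assumes "0 < k"
  shows "fold gate_act preparation (interval 0 (Suc 0)) = (\<lambda>i. of_real (1 / sqrt M) * interval 0 M i)"
proof -
  have dvd: "2 ^ l 0 dvd tail 1"
    using power_le_dvd[OF tail_dvd[of 0], of "l 0"] by simp
  have "sqrt (tail 0 / (M * 2 ^ l 0)) = (1 / sqrt 2) ^ l 0"
    using M_pos by (simp add: tail_0 real_sqrt_divide real_sqrt_power power_divide)
  moreover have "interval (tail 0) M = (\<lambda>i. 0)" by (auto simp: interval_def tail_0)
  ultimately have "fold gate_act (map (Single Hadamard) [0..<l 0]) (interval (tail 1) (Suc (tail 1))) = state 0"
    using Hadamard_chain[OF _ dvd, of 0] by (simp add: state_def[abs_def])
  moreover have "(\<Sum>j = 1..k. 2 ^ l j) = tail 1" by (simp add: tail_def)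
  ultimately have "fold gate_act preparation (interval 0 (Suc 0)) = state k"
    using run_X[of k] run_stages[of k] by (simp add: preparation_def)
  also have "\<dots> = (\<lambda>i. of_real (1 / sqrt M) * interval 0 M i)"
  proof
    fix i
    \<comment> \<open>After the last stage \<open>tail k = 2 ^ l k\<close>, so both parts have
      amplitude \<open>1 / sqrt M\<close> and together cover \<open>[0, M)\<close>.\<close>
    have "interval 0 (2 ^ l k) i + interval (2 ^ l k) M i = interval 0 M i"
      using M_lower by (auto simp: interval_def)
    then show "state k i = of_real (1 / sqrt M) * interval 0 M i"
      using tail_rec[of k] M_pos
      by (simp add: state_def tail_Suc_k real_sqrt_divide flip: add_divide_distrib)
  qed
  finally show ?thesis .
qed

section \<open>Validity and gate counts\<close>

lemma circuit_on_preparation: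
  assumes "0 < k"
  shows "circuit_on (Suc (l k)) preparation"
proof -
  have "valid_gate (Suc (l k)) g" if "g \<in> set (stage m)" "m < k" for m g
  proof -
    have "l m < l (Suc m)" "l (Suc m) \<le> l k" using that(2) by (auto intro: l_less l_le)
    then show ?thesis
      using that(1) by (auto simp: stage_def rotation_def single_qubit_unitary_RotY single_qubit_unitary_Hadamard)
  qed
  moreover have "valid_gate (Suc (l k)) (Single PauliX (l j))" if "j \<le> k" for j
    using l_le[OF that] by (simp add: single_qubit_unitary_PauliX)
  moreover have "valid_gate (Suc (l k)) (Single Hadamard q)" if "q < l 0" for q
    using that l_le[of 0 k] by (simp add: single_qubit_unitary_Hadamard)
  ultimately show ?thesis
    by (auto simp: circuit_on_def preparation_def simp del: valid_gate.simps)
qed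

lemma preparation_gates:
  "g \<in> set preparation \<Longrightarrow> is_X g \<or> is_H g \<or> is_RY g \<or> is_open_CH g \<or> is_open_CRY g"
  by (auto simp: preparation_def stage_def rotation_def split: if_splits)

lemma stage_counts:
  "count_gates is_X (stage m) = 0" "count_gates is_H (stage m) = 0"
  "count_gates is_RY (stage m) = of_bool (m = 0)"
  "count_gates is_open_CH (stage m) = l (Suc m) - l m"
  "count_gates is_open_CRY (stage m) = of_bool (m \<noteq> 0)"
  "length (stage m) = Suc (l (Suc m) - l m)"
  by (simp_all add: stage_def rotation_def filter_map comp_def)

lemma stages_counts:
  assumes "m \<le> k"
  shows "count_gates is_X (concat (map stage [0..<m])) = 0"
    "count_gates is_H (concat (map stage [0..<m])) = 0"
    "count_gates is_RY (concat (map stage [0..<m])) = of_bool (m \<noteq> 0)"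
    "count_gates is_open_CH (concat (map stage [0..<m])) = l m - l 0"
    "count_gates is_open_CRY (concat (map stage [0..<m])) = m - 1"
    "length (concat (map stage [0..<m])) = m + (l m - l 0)"
proof -
  show "count_gates is_X (concat (map stage [0..<m])) = 0"
    by (induction m) (simp_all add: stage_counts)
  show "count_gates is_H (concat (map stage [0..<m])) = 0"
    by (induction m) (simp_all add: stage_counts)
  show "count_gates is_RY (concat (map stage [0..<m])) = of_bool (m \<noteq> 0)"
    by (induction m) (simp_all add: stage_counts)
  show "count_gates is_open_CRY (concat (map stage [0..<m])) = m - 1"
    by (induction m) (simp_all add: stage_counts)
  \<comment> \<open>Truncated differences telescope only while \<open>l\<close> is increasing, so
    these two counts need \<open>m \<le> k\<close>.\<close>
  have "count_gates is_open_CH (concat (map stage [0..<m])) = l m - l 0 \<and>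
      length (concat (map stage [0..<m])) = m + (l m - l 0)"
    using assms
  proof (induction m)
    case (Suc m)
    then have "l 0 \<le> l m" "l m \<le> l (Suc m)" by (auto intro: l_le)
    moreover have "count_gates is_open_CH (concat (map stage [0..<m])) = l m - l 0"
      "length (concat (map stage [0..<m])) = m + (l m - l 0)"
      using Suc by simp_all
    ultimately show ?case by (simp add: stage_counts)
  qed simp
  then show "count_gates is_open_CH (concat (map stage [0..<m])) = l m - l 0"
    "length (concat (map stage [0..<m])) = m + (l m - l 0)" by simp_all
qed

lemma preparation_counts:
  assumes "0 < k"
  shows "count_gates is_X preparation = k" "count_gates is_H preparation = l 0"
    "count_gates is_RY preparation = 1"
    "count_gates is_open_CH preparation = l k - l 0"
    "count_gates is_open_CRY preparation = k - 1"
    "length preparation = l k + 2 * k"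
  using stages_counts[of k] assms l_le[of 0 k]
  by (simp_all add: preparation_def filter_map comp_def)

section \<open>Uniqueness and existence of the binary expansion\<close>

lemma image_l: "l ` {0..k} = set_decode M"
proof -
  have "inj_on l {0..k}" using l_mono by (rule strict_mono_on_imp_inj_on)
  then have "set_encode (l ` {0..k}) = M"
    by (simp add: set_encode_def sum.reindex M_eq)
  then show ?thesis using set_encode_inverse[of "l ` {0..k}"] by simp
qed

lemma map_l: "map l [0..<Suc k] = sorted_list_of_set (set_decode M)"
proof (rule strict_sorted_equal)
  show "sorted_wrt (<) (map l [0..<Suc k])"
    unfolding sorted_wrt_iff_nth_less by (auto simp: nth_append less_Suc_eq intro: l_less simp del: upt_Suc)
  show "set (map l [0..<Suc k]) = set (sorted_list_of_set (set_decode M))"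
    using image_l by (simp add: atLeastLessThanSuc_atLeastAtMost del: upt_Suc)
qed simp

end

text \<open>The circuit is built from one expansion, but its counts are claimed for every expansion.
  Both exponent lists equal the sorted list of \<open>set_decode M\<close>.\<close>

lemma binary_expansion_unique:
  assumes "binary_expansion k l M" and "binary_expansion k' l' M"
  shows "k = k'" and "j \<le> k \<Longrightarrow> l j = l' j"
proof -
  have eq: "map l [0..<Suc k] = map l' [0..<Suc k']"
    using assms[THEN binary_expansion.map_l] by simp
  from arg_cong[OF eq, of length] show "k = k'" by simp
  then show "l j = l' j" if "j \<le> k"
    using eq that by (simp del: upt_Suc)
qed

lemma binary_expansion_exists:
  assumes "0 < M"
  shows "\<exists>k l. binary_expansion k l M"
proof (intro exI)
  let ?xs = "sorted_list_of_set (set_decode M)"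
  have ne: "?xs \<noteq> []"
    using assms set_decode_inverse[of M] by (auto simp del: set_decode_inverse)
  \<comment> \<open>The exponents are indexed from 0 to \<open>k\<close> inclusive, so
    \<open>k\<close> is the length minus one; this is faithful only for a nonempty list.\<close>
  have "xs \<noteq> [] \<Longrightarrow> {0..length xs - 1} = {..<length xs}" for xs :: "nat list"
    by (cases xs) auto
  from this[OF ne] have range: "{0..length ?xs - 1} = {..<length ?xs}" .
  show "binary_expansion (length ?xs - 1) ((!) ?xs) M"
    unfolding binary_expansion_def range
  proof
    show "strict_mono_on {..<length ?xs} ((!) ?xs)"
      by (auto simp: strict_mono_on_def intro: sorted_wrt_nth_less[OF strict_sorted_list_of_set])
    have "(\<Sum>j<length ?xs. 2 ^ (?xs ! j)) = (\<Sum>q\<in>set ?xs. (2::nat) ^ q)"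
      by (rule sum.reindex_bij_betw[OF bij_betw_nth]) auto
    then show "M = (\<Sum>j<length ?xs. 2 ^ (?xs ! j))"
      using set_decode_inverse[of M] by (simp add: set_encode_def del: set_decode_inverse)
  qed
qed

section \<open>Depth, initial state and target state\<close>

lemma depth_le_length: "depth gs \<le> length gs"
  unfolding depth_def by (rule Least_le) (auto simp: layering_def intro!: exI[of _ id])

lemma ket_0: "ket n 0 = vec (2 ^ n) (interval 0 (Suc 0))"
  by (rule eq_vecI) (auto simp: interval_def unit_vec_def)

lemma uniform_state_eq:
  assumes "M \<le> 2 ^ n"
  shows "uniform_state n M = vec (2 ^ n) (\<lambda>i. of_real (1 / sqrt M) * interval 0 M i)"
proof (rule eq_vecI)
  fix i
  assume "i < dim_vec (vec (2 ^ n) (\<lambda>i. of_real (1 / sqrt M) * interval 0 M i))"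
  then have i: "i < 2 ^ n" by simp
  have "finsum_vec TYPE(complex) (2 ^ n) (ket n) {..<M} $ i = (\<Sum>j<M. ket n j $ i)"
    using i by (subst index_finsum_vec) auto
  also have "\<dots> = (\<Sum>j<M. if j = i then 1 else 0)"
    using i by (intro sum.cong) (use assms in \<open>auto simp: unit_vec_def\<close>)
  also have "\<dots> = interval 0 M i" by (simp add: interval_def)
  finally show "uniform_state n M $ i = vec (2 ^ n) (\<lambda>i. of_real (1 / sqrt M) * interval 0 M i) $ i"
    using i finsum_vec_closed[of "ket n" "{..<M}" "2 ^ n"]
    by (simp add: uniform_state_def carrier_vecD)
qed (use finsum_vec_closed[of "ket n" "{..<M}" "2 ^ n"] in \<open>simp add: uniform_state_def carrier_vecD\<close>)

lemma prepares_uniformI: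
  assumes "circuit_on n gs" and "M \<le> 2 ^ n"
    and "fold gate_act gs (interval 0 (Suc 0)) = (\<lambda>i. of_real (1 / sqrt M) * interval 0 M i)"
  shows "prepares_uniform n M gs"
  using assms by (simp add: prepares_uniform_def ket_0 run_circuit_vec uniform_state_eq)

section \<open>Compilation to single-qubit gates and CNOTs\<close>

lemma CNOT_compile_gate:
  assumes "valid_gate n g" and "is_X g \<or> is_H g \<or> is_RY g \<or> is_open_CH g \<or> is_open_CRY g"
  shows "\<exists>hs. circuit_on n hs \<and> (\<forall>h \<in> set hs. is_single h \<or> is_CNOT h) \<and> length hs \<le> 4 \<and>
    fold gate_act hs = gate_act g"
proof -
  consider V q where "g = Single V q" | c t where "g = Controlled False Hadamard c t"
    | \<theta> c t where "g = Controlled False (RotY \<theta>) c t"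
    using assms(2) by (auto simp: is_X_def is_H_def is_RY_def is_open_CH_def is_open_CRY_def)
  then show ?thesis
  proof cases
    case 1
    then show ?thesis
      using assms(1) by (intro exI[of _ "[g]"]) (auto simp: circuit_on_def is_single_def fun_eq_iff)
  next
    case 2
    then have "c \<noteq> t" using assms(1) by simp
    then show ?thesis
      using assms(1) 2 open_CH_decomposition[of c t]
      by (intro exI[of _ "[Single Hadamard t, Single (RotY (pi / 4)) t, CNOT c t, Single (RotY (- (pi / 4))) t]"])
        (auto simp: circuit_on_def is_single_def is_CNOT_def single_qubit_unitary_Hadamard
          single_qubit_unitary_RotY single_qubit_unitary_PauliX fun_eq_iff simp del: fold_simps gate_act.simps)
  next
    case 3
    then have "c \<noteq> t" using assms(1) by simp
    then show ?thesis
      using assms(1) 3 open_CRY_decomposition[of c t \<theta>]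
      by (intro exI[of _ "[Single (RotY (\<theta> / 2)) t, CNOT c t, Single (RotY (\<theta> / 2)) t, CNOT c t]"])
        (auto simp: circuit_on_def is_single_def is_CNOT_def
          single_qubit_unitary_RotY single_qubit_unitary_PauliX fun_eq_iff simp del: fold_simps gate_act.simps)
  qed
qed

text \<open>The replacements agree with the gates on every amplitude function, not only on the
  states reached, so they can be concatenated.\<close>

lemma CNOT_compile:
  assumes "circuit_on n gs"
    and "\<And>g. g \<in> set gs \<Longrightarrow> is_X g \<or> is_H g \<or> is_RY g \<or> is_open_CH g \<or> is_open_CRY g"
  shows "\<exists>hs. circuit_on n hs \<and> (\<forall>h \<in> set hs. is_single h \<or> is_CNOT h) \<and> length hs \<le> 4 * length gs \<and>
    fold gate_act hs = fold gate_act gs"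
  using assms
proof (induction gs)
  case (Cons g gs)
  obtain hs where hs: "circuit_on n hs" "\<forall>h \<in> set hs. is_single h \<or> is_CNOT h"
      "length hs \<le> 4 * length gs" "fold gate_act hs = fold gate_act gs"
    using Cons by (auto simp: circuit_on_def)
  obtain hs' where hs': "circuit_on n hs'" "\<forall>h \<in> set hs'. is_single h \<or> is_CNOT h"
      "length hs' \<le> 4" "fold gate_act hs' = gate_act g"
    using CNOT_compile_gate[of n g] Cons.prems by (auto simp: circuit_on_def)
  show ?case
    using hs hs' by (intro exI[of _ "hs' @ hs"]) (auto simp: circuit_on_def)
qed (auto simp: circuit_on_def)

lemma prepares_uniform_CNOT:
  assumes "prepares_uniform n M gs"
    and "\<And>g. g \<in> set gs \<Longrightarrow> is_X g \<or> is_H g \<or> is_RY g \<or> is_open_CH g \<or> is_open_CRY g"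
  shows "\<exists>hs. prepares_uniform n M hs \<and> (\<forall>h \<in> set hs. is_single h \<or> is_CNOT h) \<and>
    length hs \<le> 4 * length gs"
proof -
  have "circuit_on n gs" using assms(1) by (simp add: prepares_uniform_def)
  then obtain hs where hs: "circuit_on n hs" "\<forall>h \<in> set hs. is_single h \<or> is_CNOT h"
      "length hs \<le> 4 * length gs" "fold gate_act hs = fold gate_act gs"
    using CNOT_compile assms(2) by blast
  moreover have "run_circuit n hs (ket n 0) = run_circuit n gs (ket n 0)"
    using hs(1,4) \<open>circuit_on n gs\<close> by (simp add: ket_0 run_circuit_vec)
  ultimately show ?thesis using assms(1) by (auto simp: prepares_uniform_def)
qed

section \<open>Assembling the circuits and the bounds\<close>

lemma uniform_circuit_power_of_two:
  "prepares_uniform r (2 ^ r) (map (Single Hadamard) [0..<r])"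
proof (rule prepares_uniformI)
  show "fold gate_act (map (Single Hadamard) [0..<r]) (interval 0 (Suc 0)) =
      (\<lambda>i. of_real (1 / sqrt (real (2 ^ r))) * interval 0 (2 ^ r) i)"
    using Hadamard_chain[of 0 r 0] by (simp add: real_sqrt_power power_divide)
qed (auto simp: circuit_on_def single_qubit_unitary_Hadamard)

lemma (in binary_expansion) prepares_uniform_preparation:
  assumes "0 < k"
  shows "prepares_uniform (Suc (l k)) M preparation"
  using circuit_on_preparation[OF assms] run_preparation[OF assms] M_upper
  by (intro prepares_uniformI) auto

lemma uniform_circuit_exists:
  fixes M n :: nat
  assumes "2 \<le> M" and n: "int n = \<lceil>log 2 (real M)\<rceil>"
  shows "\<exists>gs. prepares_uniform n M gs \<and>
         (\<forall>g \<in> set gs. is_X g \<or> is_H g \<or> is_RY g \<or> is_open_CH g \<or> is_open_CRY g) \<and>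
         real (length gs) \<le> 3 * log 2 (real M) \<and>
         (\<forall>r. 1 \<le> r \<longrightarrow> M = 2 ^ r \<longrightarrow> length gs = r \<and> (\<forall>g \<in> set gs. is_H g)) \<and>
         (\<forall>(k::nat) (l::nat \<Rightarrow> nat).
            (\<nexists>r. M = 2 ^ r) \<longrightarrow> strict_mono_on {0..k} l \<longrightarrow> M = (\<Sum>j = 0..k. 2 ^ l j) \<longrightarrow>
            length gs = l k + 2 * k \<and>
            count_gates is_X gs = k \<and>
            count_gates is_RY gs = 1 \<and>
            count_gates is_H gs = l 0 \<and>
            count_gates is_open_CH gs = l k - l 0 \<and>
            count_gates is_open_CRY gs = k - 1)"
proof (cases "\<exists>r. M = 2 ^ r")
  case True
  then obtain r where r: "M = 2 ^ r" by blast
  then have log: "log 2 (real M) = r" by (simp add: log_nat_power)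
  then have "n = r" using n by simp
  then show ?thesis
    using r log uniform_circuit_power_of_two[of r]
    by (intro exI[of _ "map (Single Hadamard) [0..<r]"]) auto
next
  case False
  obtain k l where "binary_expansion k l M"
    using binary_expansion_exists assms(1) by fastforce
  then interpret binary_expansion k l M .
  \<comment> \<open>A single summand would make \<open>M\<close> a power of 2.\<close>
  have k: "0 < k" using False M_eq by (cases k) auto
  have "(2::nat) ^ l k < M" using M_lower False by (metis le_neq_implies_less)
  then have "2 ^ l k < real M" "real M \<le> 2 ^ Suc (l k)"
  proof -
    assume "2 ^ l k < M"
    then have "real (2 ^ l k) < real M" by (simp only: of_nat_less_iff)
    then show "2 ^ l k < real M" by simp
    have "real M < real (2 ^ Suc (l k))" using M_upper by (simp only: of_nat_less_iff)
    then show "real M \<le> 2 ^ Suc (l k)" by simp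
  qed
  then have "l k < log 2 (real M)" "log 2 (real M) \<le> Suc (l k)"
    using less_log_of_power[of 2 "l k" M] log_of_power_le[of M 2 "Suc (l k)"] M_pos
    by (simp_all del: power_Suc)
  then have n': "n = Suc (l k)" and len: "real (l k + 2 * k) \<le> 3 * log 2 (real M)"
  proof -
    have "\<lceil>log 2 (real M)\<rceil> = int (Suc (l k))"
      by (rule ceiling_unique) (use \<open>l k < log 2 (real M)\<close> \<open>log 2 (real M) \<le> Suc (l k)\<close> in simp_all)
    then show "n = Suc (l k)" using n by simp
    \<comment> \<open>The constant 3 comes from \<open>k \<le> l k\<close>, as the exponents are
      strictly increasing.\<close>
    show "real (l k + 2 * k) \<le> 3 * log 2 (real M)"
      using \<open>l k < log 2 (real M)\<close> k_le[of k] by simp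
  qed
  show ?thesis
  proof (intro exI[of _ preparation] conjI allI impI ballI)
    show "prepares_uniform n M preparation"
      using prepares_uniform_preparation[OF k] n' by simp
    show "real (length preparation) \<le> 3 * log 2 (real M)"
      using len by (simp add: preparation_counts k)
    show "is_X g \<or> is_H g \<or> is_RY g \<or> is_open_CH g \<or> is_open_CRY g"
      if "g \<in> set preparation" for g
      using that by (rule preparation_gates)
    show "length preparation = r" "is_H g" if "M = 2 ^ r" for r g
      using that False by blast+
    fix k' :: nat and l' :: "nat \<Rightarrow> nat"
    assume "strict_mono_on {0..k'} l'" "M = (\<Sum>j = 0..k'. 2 ^ l' j)"
    then have "binary_expansion k' l' M" by (simp add: binary_expansion_def)
    note binary_expansion_unique[OF binary_expansion_axioms this]
    then have eq: "k' = k" "l' k' = l k" "l' 0 = l 0" by auto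
    show "length preparation = l' k' + 2 * k'" "count_gates is_X preparation = k'"
      "count_gates is_RY preparation = 1" "count_gates is_H preparation = l' 0"
      "count_gates is_open_CH preparation = l' k' - l' 0" "count_gates is_open_CRY preparation = k' - 1"
      using preparation_counts[OF k] eq by simp_all
  qed
qed

theorem mainTheorem1:
  shows "\<exists>C::real. C > 0 \<and>
    (\<forall>(M::nat) (n::nat). 2 \<le> M \<longrightarrow> int n = \<lceil>log 2 (real M)\<rceil> \<longrightarrow>
      (\<exists>gs. prepares_uniform n M gs \<and>
         (\<forall>g \<in> set gs. is_X g \<or> is_H g \<or> is_RY g \<or> is_open_CH g \<or> is_open_CRY g) \<and>
         real (length gs) \<le> C * log 2 (real M) \<and>
         real (depth gs) \<le> C * log 2 (real M) \<and>
         (\<forall>r. 1 \<le> r \<longrightarrow> M = 2 ^ r \<longrightarrow> length gs = r \<and> (\<forall>g \<in> set gs. is_H g)) \<and>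
         (\<forall>(k::nat) (l::nat \<Rightarrow> nat).
            (\<nexists>r. M = 2 ^ r) \<longrightarrow> strict_mono_on {0..k} l \<longrightarrow> M = (\<Sum>j = 0..k. 2 ^ l j) \<longrightarrow>
            length gs = l k + 2 * k \<and>
            count_gates is_X gs = k \<and>
            count_gates is_RY gs = 1 \<and>
            count_gates is_H gs = l 0 \<and>
            count_gates is_open_CH gs = l k - l 0 \<and>
            count_gates is_open_CRY gs = k - 1)) \<and>
      (\<exists>gs. prepares_uniform n M gs \<and>
         (\<forall>g \<in> set gs. is_single g \<or> is_CNOT g) \<and>
         real (length gs) \<le> C * log 2 (real M)))"
proof (intro exI[of _ "12::real"] conjI allI impI)
  \<comment> \<open>The constant 12 is the bound 3 for the direct circuit times the factor 4 of the
    compilation.\<close>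
  fix M n :: nat
  assume M: "2 \<le> M" and n: "int n = \<lceil>log 2 (real M)\<rceil>"
  obtain gs where gs: "prepares_uniform n M gs"
    "\<And>g. g \<in> set gs \<Longrightarrow> is_X g \<or> is_H g \<or> is_RY g \<or> is_open_CH g \<or> is_open_CRY g"
    "real (length gs) \<le> 3 * log 2 (real M)"
    and exact: "\<forall>r. 1 \<le> r \<longrightarrow> M = 2 ^ r \<longrightarrow> length gs = r \<and> (\<forall>g \<in> set gs. is_H g)"
      "\<forall>(k::nat) (l::nat \<Rightarrow> nat).
        (\<nexists>r. M = 2 ^ r) \<longrightarrow> strict_mono_on {0..k} l \<longrightarrow> M = (\<Sum>j = 0..k. 2 ^ l j) \<longrightarrow>
        length gs = l k + 2 * k \<and> count_gates is_X gs = k \<and> count_gates is_RY gs = 1 \<and>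
        count_gates is_H gs = l 0 \<and> count_gates is_open_CH gs = l k - l 0 \<and>
        count_gates is_open_CRY gs = k - 1"
    using uniform_circuit_exists[OF M n] by blast
  have "0 \<le> log 2 (real M)" using M by simp
  then have len: "real (length gs) \<le> 12 * log 2 (real M)" using gs(3) by linarith
  moreover have "real (depth gs) \<le> 12 * log 2 (real M)"
    using len depth_le_length[of gs] by linarith
  ultimately show "\<exists>gs. prepares_uniform n M gs \<and>
         (\<forall>g \<in> set gs. is_X g \<or> is_H g \<or> is_RY g \<or> is_open_CH g \<or> is_open_CRY g) \<and>
         real (length gs) \<le> 12 * log 2 (real M) \<and>
         real (depth gs) \<le> 12 * log 2 (real M) \<and>
         (\<forall>r. 1 \<le> r \<longrightarrow> M = 2 ^ r \<longrightarrow> length gs = r \<and> (\<forall>g \<in> set gs. is_H g)) \<and>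
         (\<forall>(k::nat) (l::nat \<Rightarrow> nat).
            (\<nexists>r. M = 2 ^ r) \<longrightarrow> strict_mono_on {0..k} l \<longrightarrow> M = (\<Sum>j = 0..k. 2 ^ l j) \<longrightarrow>
            length gs = l k + 2 * k \<and>
            count_gates is_X gs = k \<and>
            count_gates is_RY gs = 1 \<and>
            count_gates is_H gs = l 0 \<and>
            count_gates is_open_CH gs = l k - l 0 \<and>
            count_gates is_open_CRY gs = k - 1)"
    using gs(1,2) exact by (intro exI[of _ gs] conjI ballI) blast+
  obtain hs where "prepares_uniform n M hs" "\<forall>h \<in> set hs. is_single h \<or> is_CNOT h"
      "length hs \<le> 4 * length gs"
    using prepares_uniform_CNOT[OF gs(1,2)] by blast
  moreover from this(3) have "real (length hs) \<le> 12 * log 2 (real M)"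
    using gs(3) by linarith
  ultimately show "\<exists>gs. prepares_uniform n M gs \<and>
         (\<forall>g \<in> set gs. is_single g \<or> is_CNOT g) \<and>
         real (length gs) \<le> 12 * log 2 (real M)" by blast
qed simp

end
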